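(* Renaming of variables preserves the rank $\rho$ of auxiliary terms. If $M$ is an auxiliary term in context $\Gamma$, $\beta$ is an ordinal, and every image of a typed simultaneous substitution $\vartheta$ from $\Gamma$ to $\Delta$ has rank at most $\beta$, then $$\rho(M[\vartheta])\le\beta+\rho(M).$$ In particular, $\rho(U[V/x])\le\rho(V)+\rho(U)$ for auxiliary terms $\Gamma,x:\sigma\vdash U:\tau$ and $\Gamma\vdash V:\sigma$.
   Context: Ordinals are classical with ordinary ordinal arithmetic; $\vee$ is binary supremum. **Auxiliary (infinitary) terms.** Simple types: $\sigma,\tau::=\iota\mid\sigma\to\tau$. Typed terms in contexts are inductively generated (well-founded, possibly countably branching), up to renaming of bound variables, by variables, abstraction $\lambda x^\sigma.M$, application with the usual typing, literals $\Gamma\vdash\underline n:\iota$ ($n\in\mathbb N$), queries $\Gamma\vdash\mathsf{query}_i(n\mapsto M_n):\iota$ ($i\in\mathbb N$, $\Gamma\vdash M_n:\iota$ for all $n\in\mathbb N$), and selections $\Gamma\vdash\mathsf{case}(M;\,n\mapsto M_n):\iota$ ($\Gamma\vdash M:\iota$, $\Gamma\vdash M_n:\iota$ for all $n$). **Substitution.** A typed simultaneous substitution $\vartheta$ from $\Gamma$ to $\Delta$ assigns a term $\Delta\vdash\vartheta(x):\sigma$ to each declaration $x:\sigma$ of $\Gamma$; $M[\vartheta]$ is its capture-avoiding action, extending to selectors and all branches. A renaming is the action of a type-preserving map from the variables of $\Gamma$ to those of $\Delta$. $U[V/x]$ replaces $x$ by $V$ and fixes all other variables. **Rank.** $\rho(x)=\rho(\underline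 n)=0$; $\rho(\lambda x^\sigma.M)=\rho(M)+1$; $\rho(F\,V)=(\rho(F)\vee\rho(V))+1$; $\rho(\mathsf{query}_i(n\mapsto M_n))=(\sup_n\rho(M_n))+1$; $\rho(\mathsf{case}(M;n\mapsto M_n))=(\rho(M)\vee\sup_n\rho(M_n))+1$. *)

theory Defs
  imports "HOL-Library.Infinite_Typeclass"
begin

section \<open>Ordinals\<close>

unbundle cardinal_syntax

text \<open>
  HOL has no type of all ordinals. The type \<open>'a ordinal\<close> consists of the order types of all
  well-orders whose field is a set of elements of \<open>'a\<close>, i.e. for infinite \<open>'a\<close> it is the initial
  segment of the ordinals below the successor cardinal of the cardinality of \<open>'a\<close>. Every ordinal
  lies in such a segment, so a statement about all \<open>x :: 'a :: infinite ordinal\<close>, with the type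
  variable \<open>'a\<close> left free, is a statement about arbitrary ordinals. (The order type of a
  well-order on any type \<open>'b\<close> is found in \<open>'a ordinal\<close> for every infinite \<open>'a\<close> containing a copy
  of \<open>'b\<close>, e.g. \<open>'b list\<close>.) For infinite \<open>'a\<close> the segment
  is closed under successors, suprema of sequences, and sums.
\<close>

quotient_type 'a ordinal = "'a rel" / partial: "\<lambda>r s. (r, s) \<in> ordIso"
proof (rule part_equivpI)
  have "Well_order ({} :: 'a rel)" by (simp add: order_on_defs refl_on_def trans_def antisym_def total_on_def)
  then show "\<exists>r :: 'a rel. (r, r) \<in> ordIso" using ordIso_reflexive by blast
  show "symp (\<lambda>r s :: 'a rel. (r, s) \<in> ordIso)"
    by (auto intro!: sympI ordIso_symmetric)
  show "transp (\<lambda>r s :: 'a rel. (r, s) \<in> ordIso)"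
    by (auto intro!: transpI elim: ordIso_transitive)
qed

lemma ordIso_refl_iff: "(r, r) \<in> ordIso \<longleftrightarrow> Well_order r"
  using ordIso_reflexive by (auto simp: ordIso_def)

instantiation ordinal :: (type) wellorder
begin

lift_definition less_eq_ordinal :: "'a ordinal \<Rightarrow> 'a ordinal \<Rightarrow> bool" is "\<lambda>r s. (r, s) \<in> ordLeq"
  using ordIso_ordLeq_trans ordLeq_ordIso_trans ordIso_symmetric by blast

lift_definition less_ordinal :: "'a ordinal \<Rightarrow> 'a ordinal \<Rightarrow> bool" is "\<lambda>r s. (r, s) \<in> ordLess"
  using ordIso_ordLess_trans ordLess_ordIso_trans ordIso_symmetric by blast

instance
proof
  fix x y z :: "'a ordinal"
  show "x < y \<longleftrightarrow> x \<le> y \<and> \<not> y \<le> x"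
    by transfer (use not_ordLess_iff_ordLeq ordLess_imp_ordLeq in \<open>auto simp: ordIso_refl_iff\<close>)
  show "x \<le> x" by transfer (simp add: ordIso_refl_iff ordLeq_reflexive)
  show "x \<le> y \<Longrightarrow> y \<le> z \<Longrightarrow> x \<le> z" by transfer (rule ordLeq_transitive)
  show "x \<le> y \<Longrightarrow> y \<le> x \<Longrightarrow> x = y" by transfer (simp add: ordIso_iff_ordLeq)
  show "x \<le> y \<or> y \<le> x" by transfer (simp add: ordIso_refl_iff ordLeq_total)
next
  fix P :: "'a ordinal \<Rightarrow> bool" and x
  assume step: "\<And>x. (\<And>y. y < x \<Longrightarrow> P y) \<Longrightarrow> P x"
  have "wf {(x, y :: 'a ordinal). x < y}"
  proof (rule wf_subset[OF wf_inv_image[OF wf_ordLess]])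
    show "{(x, y :: 'a ordinal). x < y} \<subseteq> inv_image ordLess rep_ordinal"
      by (auto simp: less_ordinal_def)
  qed
  then show "P x"
    by (induction x rule: wf_induct_rule) (use step in auto)
qed

end

instantiation ordinal :: (type) conditionally_complete_linorder
begin

definition "sup_ordinal = (max :: 'a ordinal \<Rightarrow> _)"
definition "inf_ordinal = (min :: 'a ordinal \<Rightarrow> _)"
definition "Inf_ordinal (X :: 'a ordinal set) = (LEAST x. x \<in> X)"
definition "Sup_ordinal (X :: 'a ordinal set) = (LEAST z. \<forall>x\<in>X. x \<le> z)"

instance
proof
  fix x y z :: "'a ordinal" and X :: "'a ordinal set"
  show "inf x y \<le> x" "inf x y \<le> y" "x \<le> sup x y" "y \<le> sup x y"
    by (auto simp: inf_ordinal_def sup_ordinal_def)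
  show "x \<le> y \<Longrightarrow> x \<le> z \<Longrightarrow> x \<le> inf y z" "y \<le> x \<Longrightarrow> z \<le> x \<Longrightarrow> sup y z \<le> x"
    by (auto simp: inf_ordinal_def sup_ordinal_def)
  show "x \<in> X \<Longrightarrow> bdd_below X \<Longrightarrow> Inf X \<le> x"
    by (simp add: Inf_ordinal_def Least_le)
  show "z \<le> Inf X" if "X \<noteq> {}" "\<And>x. x \<in> X \<Longrightarrow> z \<le> x"
  proof -
    from that(1) obtain u where "u \<in> X" by blast
    from LeastI[of "\<lambda>u. u \<in> X", OF this] that(2) show ?thesis
      by (simp add: Inf_ordinal_def)
  qed
  show "x \<le> Sup X" if "x \<in> X" "bdd_above X"
  proof -
    from that(2) obtain u where "\<forall>x\<in>X. x \<le> u" by (auto simp: bdd_above_def)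
    from LeastI[of "\<lambda>u. \<forall>x\<in>X. x \<le> u", OF this] that(1) show ?thesis
      by (simp add: Sup_ordinal_def)
  qed
  show "X \<noteq> {} \<Longrightarrow> (\<And>x. x \<in> X \<Longrightarrow> x \<le> z) \<Longrightarrow> Sup X \<le> z"
    unfolding Sup_ordinal_def by (simp add: Least_le)
qed

end

definition osuc :: "'a::infinite ordinal \<Rightarrow> 'a ordinal" where
  "osuc x = (LEAST y. x < y)"

text \<open>
  Addition by transfinite recursion on the second summand:
  \<open>x + y\<close> is the supremum of \<open>x\<close> and of all \<open>(x + z) + 1\<close> with \<open>z < y\<close>.
\<close>

function oplus :: "'a::infinite ordinal \<Rightarrow> 'a ordinal \<Rightarrow> 'a ordinal" where
  "oplus x y = Sup (insert x ((\<lambda>z. osuc (oplus x z)) ` {..<y}))"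
  by auto
termination
proof (relation "inv_image {(x, y). x < y} snd")
  show "wf (inv_image {(x, y :: 'a ordinal). x < y} (snd :: 'a ordinal \<times> 'a ordinal \<Rightarrow> _))"
    by (rule wf_inv_image) (rule wf)
qed simp

declare oplus.simps [simp del]

instantiation ordinal :: (infinite) "{zero, one, plus}"
begin
definition zero_ordinal :: "'a ordinal" where "zero_ordinal = (LEAST x. True)"
definition one_ordinal :: "'a ordinal" where "one_ordinal = osuc 0"
definition plus_ordinal :: "'a ordinal \<Rightarrow> 'a ordinal \<Rightarrow> 'a ordinal" where "plus_ordinal = oplus"
instance ..
end


subsection \<open>Closure properties and the usual recursion equations\<close>

lemma card_of_lessThan_ordinal:
  fixes x :: "'a ordinal"
  shows "|{..<x}| \<le>o |UNIV :: 'a set|"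
proof -
  define r where "r = rep_ordinal x"
  have r: "Well_order r" "x = abs_ordinal r"
    using Quotient3_rep_reflp[OF Quotient3_ordinal, of x] Quotient3_abs_rep[OF Quotient3_ordinal, of x]
    by (auto simp: r_def ordIso_refl_iff)
  have "{..<x} \<subseteq> (\<lambda>a. abs_ordinal (Restr r (underS r a))) ` UNIV"
  proof
    fix y assume "y \<in> {..<x}"
    define s where "s = rep_ordinal y"
    have s: "Well_order s" "y = abs_ordinal s"
      using Quotient3_rep_reflp[OF Quotient3_ordinal, of y] Quotient3_abs_rep[OF Quotient3_ordinal, of y]
      by (auto simp: s_def ordIso_refl_iff)
    have "(s, r) \<in> ordLess"
      using \<open>y \<in> {..<x}\<close> by (simp add: less_ordinal_def r_def s_def)
    then obtain a where "s =o Restr r (underS r a)"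
      using ordLess_iff_ordIso_Restr[OF r(1) s(1)] by auto
    then show "y \<in> (\<lambda>a. abs_ordinal (Restr r (underS r a))) ` UNIV"
      using Quotient3_rel_abs[OF Quotient3_ordinal] s(2) by auto
  qed
  then show ?thesis
    using card_of_mono1 card_of_image ordLeq_transitive by blast
qed

lemma card_of_UNIV_ordinal: "\<not> |UNIV :: 'a ordinal set| \<le>o |UNIV :: 'a set|"
proof
  assume "|UNIV :: 'a ordinal set| \<le>o |UNIV :: 'a set|"
  then obtain h :: "'a ordinal \<Rightarrow> 'a" where h: "inj h"
    by (metis card_of_ordLeq)
  define R where "R = {(x, y :: 'a ordinal). x \<le> y}"
  have FR: "Field R = UNIV" by (auto simp: R_def Field_def)
  have "wf (R - Id)"
    by (rule wf_subset[OF wellorder_class.wf]) (auto simp: R_def)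
  then have R: "Well_order R"
    unfolding well_order_on_def linear_order_on_def partial_order_on_def preorder_on_def FR
    by (auto simp: R_def refl_on_def trans_def antisym_def total_on_def)
  define T where "T x = Restr R (underS R x)" for x
  have uR: "underS R x = {..<x}" for x by (auto simp: R_def underS_def)
  have T: "Well_order (T x)" for x unfolding T_def by (rule Well_order_Restr[OF R])
  have FT: "Field (T x) = {..<x}" for x
    by (auto simp: T_def uR Field_def) (auto simp: R_def)
  have T_less_R: "(T x, R) \<in> ordLess" for x
    unfolding T_def by (rule underS_Restr_ordLess[OF R]) (simp add: FR)
  have T_less: "(T x, T y) \<in> ordLess" if "x < y" for x y
  proof -
    have "T x = Restr (T y) (underS (T y) x)"
      using that by (auto simp: T_def uR R_def underS_def)
    then show ?thesis
      using underS_Restr_ordLess[OF T[of y], of x] that FT[of y] by auto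
  qed
  define C where "C r = dir_image r h" for r
  have C: "r =o C r" if "Well_order r" for r
    unfolding C_def using that h by (intro dir_image_ordIso) (auto intro: inj_on_subset)
  have C_wf: "Well_order (C r)" if "Well_order r" for r
    unfolding C_def using that h by (intro Well_order_dir_image) (auto intro: inj_on_subset)
  have C_less: "abs_ordinal (C r) < abs_ordinal (C s)"
    if "(r, s) \<in> ordLess" "Well_order r" "Well_order s" for r s
  proof -
    have "(C r, C s) \<in> ordLess"
      by (rule ordLess_ordIso_trans[OF ordIso_ordLess_trans[OF ordIso_symmetric[OF C[OF that(2)]] that(1)]
            C[OF that(3)]])
    then show ?thesis
      using that by (simp add: less_ordinal.abs_eq ordIso_refl_iff C_wf)
  qed
  define g where "g x = abs_ordinal (C (T x))" for x
  have g_mono: "g x < g y" if "x < y" for x y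
    unfolding g_def using T_less[OF that] T by (intro C_less)
  have g_ge: "x \<le> g x" for x
  proof (induction x rule: less_induct)
    case (less x)
    show ?case
    proof (rule ccontr)
      assume "\<not> x \<le> g x"
      then have "g x < x" by simp
      with less g_mono[OF this] show False by fastforce
    qed
  qed
  have "g x < abs_ordinal (C R)" for x
    unfolding g_def using T_less_R T R by (intro C_less)
  with g_ge show False by (meson less_le_not_le)
qed

lemma ordinal_strict_bound:
  fixes A :: "'a::infinite ordinal set"
  assumes "|A| \<le>o |UNIV :: 'a set|"
  shows "\<exists>z. \<forall>x\<in>A. x < z"
proof (rule ccontr)
  assume "\<not> ?thesis"
  then have "UNIV = (\<Union>x\<in>A. {..x})"
    by (metis (no_types, lifting) UNIV_eq_I UN_I atMost_iff not_less)
  moreover have inf: "infinite (UNIV :: 'a set)" by (rule infinite_UNIV)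
  moreover have "|{..x}| \<le>o |UNIV :: 'a set|" for x :: "'a ordinal"
  proof -
    have "{..x} = {..<x} \<union> {x}" by auto
    moreover have "|{x}| \<le>o |UNIV :: 'a set|"
      using card_of_singl_ordLeq[of UNIV x] by auto
    then have "|{..<x} \<union> {x}| \<le>o |UNIV :: 'a set|"
      by (intro card_of_Un_ordLeq_infinite_Field card_of_lessThan_ordinal card_of_Card_order)
        (simp_all add: inf Field_card_of)
    ultimately show ?thesis by (simp only:)
  qed
  ultimately have "|UNIV :: 'a ordinal set| \<le>o |UNIV :: 'a set|"
    using card_of_UNION_ordLeq_infinite[OF inf assms, of atMost] by simp
  then show False using card_of_UNIV_ordinal by blast
qed

lemma bdd_above_ordinal:
  fixes A :: "'a::infinite ordinal set"
  assumes "|A| \<le>o |UNIV :: 'a set|"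
  shows "bdd_above A"
  using ordinal_strict_bound[OF assms] by (meson bdd_above.I less_imp_le)

lemma bdd_above_range_ordinal:
  fixes f :: "nat \<Rightarrow> 'a::infinite ordinal"
  shows "bdd_above (range f)"
proof (rule bdd_above_ordinal)
  have "|UNIV :: nat set| \<le>o |UNIV :: 'a set|"
    using infinite_UNIV infinite_iff_card_of_nat by blast
  then show "|range f| \<le>o |UNIV :: 'a set|"
    using card_of_image ordLeq_transitive by blast
qed

lemma less_osuc: "x < osuc x"
proof -
  have "|{x}| \<le>o |UNIV :: 'a set|"
    using card_of_singl_ordLeq[of UNIV x] by auto
  from ordinal_strict_bound[OF this] show ?thesis
    unfolding osuc_def by (auto intro: LeastI)
qed

lemma osuc_le_iff: "osuc x \<le> y \<longleftrightarrow> x < y"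
  using less_osuc[of x] by (auto simp: osuc_def intro: Least_le less_le_trans)

lemma less_osuc_iff: "x < osuc y \<longleftrightarrow> x \<le> y"
  by (meson osuc_le_iff not_le)

lemma zero_le_ordinal: "0 \<le> (x :: 'a::infinite ordinal)"
  by (simp add: zero_ordinal_def Least_le)

lemma bdd_above_oplus_aux:
  "bdd_above (insert x ((\<lambda>z. osuc (x + z)) ` {..<y}))" for x :: "'a::infinite ordinal"
  using bdd_above_ordinal[OF ordLeq_transitive[OF card_of_image card_of_lessThan_ordinal]] by simp

lemma plus_ordinal_le_iff:
  fixes x :: "'a::infinite ordinal"
  shows "x + y \<le> u \<longleftrightarrow> x \<le> u \<and> (\<forall>z<y. x + z < u)"
  using bdd_above_oplus_aux[of x y]
  by (subst plus_ordinal_def, subst oplus.simps)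
     (auto simp: plus_ordinal_def[symmetric] cSup_le_iff osuc_le_iff)

lemma plus_ordinal_0: "x + 0 = (x :: 'a::infinite ordinal)"
proof (rule antisym)
  show "x + 0 \<le> x"
    unfolding plus_ordinal_le_iff using zero_le_ordinal by (auto dest: leD)
  show "x \<le> x + 0"
    using plus_ordinal_le_iff[of x 0 "x + 0"] by blast
qed

lemma plus_ordinal_strict_mono: "y < z \<Longrightarrow> x + y < x + (z :: 'a::infinite ordinal)"
  using plus_ordinal_le_iff[of x z "x + z"] by blast

lemma plus_ordinal_osuc: "x + osuc y = osuc (x + y)" for x :: "'a::infinite ordinal"
proof (rule antisym)
  have "x \<le> x + y" using plus_ordinal_le_iff[of x y "x + y"] by blast
  moreover have "x + z \<le> x + y" if "z \<le> y" for z
    using that plus_ordinal_strict_mono[of z y x] by (cases "z = y") (auto intro: less_imp_le)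
  ultimately show "x + osuc y \<le> osuc (x + y)"
    by (auto simp: plus_ordinal_le_iff less_osuc_iff intro: order_trans less_imp_le[OF less_osuc])
  show "osuc (x + y) \<le> x + osuc y"
    by (simp add: osuc_le_iff plus_ordinal_strict_mono less_osuc)
qed

lemma plus_ordinal_1: "x + 1 = osuc x" for x :: "'a::infinite ordinal"
  by (simp add: one_ordinal_def plus_ordinal_osuc plus_ordinal_0)

lemma plus_ordinal_limit:
  fixes x y :: "'a::infinite ordinal"
  assumes "y \<noteq> 0" and lim: "\<And>z. z < y \<Longrightarrow> osuc z < y"
  shows "x + y = (SUP z\<in>{..<y}. x + z)"
proof (rule antisym)
  have bdd: "bdd_above ((\<lambda>z. x + z) ` {..<y})"
    by (rule bdd_above_ordinal[OF ordLeq_transitive[OF card_of_image card_of_lessThan_ordinal]])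
  have 0: "0 \<in> {..<y}" using assms(1) zero_le_ordinal[of y] by auto
  show "x + y \<le> (SUP z\<in>{..<y}. x + z)"
    unfolding plus_ordinal_le_iff
  proof (intro conjI allI impI)
    show "x \<le> (SUP z\<in>{..<y}. x + z)"
      using cSUP_upper[OF 0 bdd] by (simp add: plus_ordinal_0)
    fix z assume "z < y"
    then have "osuc (x + z) \<le> (SUP z\<in>{..<y}. x + z)"
      using cSUP_upper[OF _ bdd, of "osuc z"] lim by (simp add: plus_ordinal_osuc)
    then show "x + z < (SUP z\<in>{..<y}. x + z)" by (simp add: osuc_le_iff)
  qed
  show "(SUP z\<in>{..<y}. x + z) \<le> x + y"
    using 0 by (intro cSUP_least) (auto intro: less_imp_le plus_ordinal_strict_mono)
qed


unbundle no cardinal_syntax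


section \<open>Auxiliary terms\<close>

datatype ty = Iota | Fun ty ty  (infixr \<open>\<rightarrow>\<^sub>t\<close> 60)

text \<open>
  De Bruijn indices represent terms up to renaming of bound variables; a context is the list of
  types of its variables, the most recently declared one (index \<open>0\<close>) first. The branches of
  \<open>Query\<close> and \<open>Case\<close> are not under a binder.
\<close>

datatype trm =
    Var nat
  | Lam ty trm
  | App trm trm
  | Lit nat
  | Query nat "nat \<Rightarrow> trm"
  | Case trm "nat \<Rightarrow> trm"

type_synonym ctx = "ty list"

inductive typed :: "ctx \<Rightarrow> trm \<Rightarrow> ty \<Rightarrow> bool"  (\<open>_ \<turnstile> _ : _\<close> [50, 50, 50] 50) where
  Var: "i < length \<Gamma> \<Longrightarrow> \<Gamma> \<turnstile> Var i : \<Gamma> ! i"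
| Lam: "\<sigma> # \<Gamma> \<turnstile> M : \<tau> \<Longrightarrow> \<Gamma> \<turnstile> Lam \<sigma> M : \<sigma> \<rightarrow>\<^sub>t \<tau>"
| App: "\<Gamma> \<turnstile> F : \<sigma> \<rightarrow>\<^sub>t \<tau> \<Longrightarrow> \<Gamma> \<turnstile> V : \<sigma> \<Longrightarrow> \<Gamma> \<turnstile> App F V : \<tau>"
| Lit: "\<Gamma> \<turnstile> Lit n : Iota"
| Query: "(\<And>n. \<Gamma> \<turnstile> M n : Iota) \<Longrightarrow> \<Gamma> \<turnstile> Query i M : Iota"
| Case: "\<Gamma> \<turnstile> N : Iota \<Longrightarrow> (\<And>n. \<Gamma> \<turnstile> M n : Iota) \<Longrightarrow> \<Gamma> \<turnstile> Case N M : Iota"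


subsection \<open>Renaming and substitution\<close>

primrec rename :: "(nat \<Rightarrow> nat) \<Rightarrow> trm \<Rightarrow> trm" where
  "rename \<xi> (Var i) = Var (\<xi> i)"
| "rename \<xi> (Lam \<sigma> M) = Lam \<sigma> (rename (case_nat 0 (\<lambda>i. Suc (\<xi> i))) M)"
| "rename \<xi> (App F V) = App (rename \<xi> F) (rename \<xi> V)"
| "rename \<xi> (Lit n) = Lit n"
| "rename \<xi> (Query i M) = Query i (\<lambda>n. rename \<xi> (M n))"
| "rename \<xi> (Case N M) = Case (rename \<xi> N) (\<lambda>n. rename \<xi> (M n))"

primrec subst :: "(nat \<Rightarrow> trm) \<Rightarrow> trm \<Rightarrow> trm" where
  "subst \<theta> (Var i) = \<theta> i"
| "subst \<theta> (Lam \<sigma> M) = Lam \<sigma> (subst (case_nat (Var 0) (\<lambda>i. rename Suc (\<theta> i))) M)"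
| "subst \<theta> (App F V) = App (subst \<theta> F) (subst \<theta> V)"
| "subst \<theta> (Lit n) = Lit n"
| "subst \<theta> (Query i M) = Query i (\<lambda>n. subst \<theta> (M n))"
| "subst \<theta> (Case N M) = Case (subst \<theta> N) (\<lambda>n. subst \<theta> (M n))"

lemma subst_Var_eq_rename: "subst (\<lambda>i. Var (\<xi> i)) M = rename \<xi> M"
proof (induction M arbitrary: \<xi>)
  case (Lam \<sigma> M)
  have "case_nat (Var 0) (\<lambda>i. rename Suc (Var (\<xi> i)))
      = (\<lambda>i. Var (case_nat 0 (\<lambda>i. Suc (\<xi> i)) i))"
    by (auto split: nat.split)
  then show ?case using Lam by simp
qed simp_all

text \<open>
  Renamings and substitutions are total functions on indices, but only their values on the
  variables of the source context are constrained.
\<close>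

definition typed_ren :: "ctx \<Rightarrow> ctx \<Rightarrow> (nat \<Rightarrow> nat) \<Rightarrow> bool" where
  "typed_ren \<Gamma> \<Delta> \<xi> \<longleftrightarrow> (\<forall>i < length \<Gamma>. \<xi> i < length \<Delta> \<and> \<Delta> ! \<xi> i = \<Gamma> ! i)"

definition typed_subst :: "ctx \<Rightarrow> ctx \<Rightarrow> (nat \<Rightarrow> trm) \<Rightarrow> bool" where
  "typed_subst \<Gamma> \<Delta> \<theta> \<longleftrightarrow> (\<forall>i < length \<Gamma>. \<Delta> \<turnstile> \<theta> i : \<Gamma> ! i)"

text \<open>\<open>U[V/x]\<close> for the most recently declared variable \<open>x\<close>; the other variables of \<open>\<Gamma>, x:\<sigma>\<close> are
  mapped to themselves as variables of \<open>\<Gamma>\<close>.\<close>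

definition subst1 :: "trm \<Rightarrow> trm \<Rightarrow> trm" where
  "subst1 U V = subst (case_nat V Var) U"


subsection \<open>Rank\<close>

text \<open>
  All ranks are countable ordinals, hence exist in \<open>'a ordinal\<close> for every infinite \<open>'a\<close>; the type
  argument only selects the segment of ordinals in which the rank is compared and added. The
  suprema are proper ones by \<open>bdd_above_range_ordinal\<close>.
\<close>

primrec rank :: "trm \<Rightarrow> 'a::infinite ordinal" where
  "rank (Var i) = 0"
| "rank (Lit n) = 0"
| "rank (Lam \<sigma> M) = rank M + 1"
| "rank (App F V) = sup (rank F) (rank V) + 1"
| "rank (Query i M) = (SUP n. rank (M n)) + 1"
| "rank (Case N M) = sup (rank N) (SUP n. rank (M n)) + 1"


subsection \<open>Typing is preserved\<close>

lemma typing_rename: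
  "\<Gamma> \<turnstile> M : \<tau> \<Longrightarrow> typed_ren \<Gamma> \<Delta> \<xi> \<Longrightarrow> \<Delta> \<turnstile> rename \<xi> M : \<tau>"
proof (induction arbitrary: \<Delta> \<xi> rule: typed.induct)
  case (Var i \<Gamma>)
  then show ?case using typed.Var[of "\<xi> i" \<Delta>] by (simp add: typed_ren_def)
next
  case (Lam \<sigma> \<Gamma> M \<tau>)
  have "typed_ren (\<sigma> # \<Gamma>) (\<sigma> # \<Delta>) (case_nat 0 (\<lambda>i. Suc (\<xi> i)))"
    using Lam.prems by (auto simp: typed_ren_def split: nat.split)
  then show ?case by (auto intro: typed.Lam Lam.IH)
next
  case (App \<Gamma> F \<sigma> \<tau> V)
  show ?case
    unfolding rename.simps by (rule typed.App) (rule App.IH, rule App.prems)+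
qed (auto intro: typed.intros)

lemma typing_subst:
  "\<Gamma> \<turnstile> M : \<tau> \<Longrightarrow> typed_subst \<Gamma> \<Delta> \<theta> \<Longrightarrow> \<Delta> \<turnstile> subst \<theta> M : \<tau>"
proof (induction arbitrary: \<Delta> \<theta> rule: typed.induct)
  case (Lam \<sigma> \<Gamma> M \<tau>)
  have "typed_ren \<Delta> (\<sigma> # \<Delta>) Suc" by (simp add: typed_ren_def)
  then have "typed_subst (\<sigma> # \<Gamma>) (\<sigma> # \<Delta>) (case_nat (Var 0) (\<lambda>i. rename Suc (\<theta> i)))"
    using Lam.prems typed.Var[of 0 "\<sigma> # \<Delta>"]
    by (auto simp: typed_subst_def typing_rename split: nat.split)
  then show ?case by (auto intro: typed.Lam Lam.IH)
next
  case (App \<Gamma> F \<sigma> \<tau> V)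
  show ?case
    unfolding subst.simps by (rule typed.App) (rule App.IH, rule App.prems)+
qed (auto simp: typed_subst_def intro: typed.intros)

lemma typing_subst1:
  assumes "\<sigma> # \<Gamma> \<turnstile> U : \<tau>" "\<Gamma> \<turnstile> V : \<sigma>"
  shows "\<Gamma> \<turnstile> subst1 U V : \<tau>"
  unfolding subst1_def using assms(1)
  by (rule typing_subst) (use assms(2) in \<open>auto simp: typed_subst_def less_Suc_eq_0_disj intro: typed.Var\<close>)

end

theory Submission
  imports Defs
begin

text \<open>The map z |-> \<beta> + z is monotone and commutes with successor, and
  \<open>rank\<close> is 0 at variables and literals and a successor of a supremum elsewhere. So a
  bound \<beta> + \<open>rank\<close> on the immediate subterms passes to the whole term
  (\<open>plus_one_le_plus_ordinal\<close>, \<open>sup_le_plus_ordinal\<close>,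
  \<open>SUP_le_plus_ordinal\<close>); at a variable it reads \<beta> + 0 = \<beta>. Under a binder
  the images are weakened, which by \<open>rank_rename\<close> leaves their ranks, and hence
  \<beta>, unchanged.\<close>

lemma plus_ordinal_mono_right: "y \<le> z \<Longrightarrow> x + y \<le> x + z" for x y z :: "'a::infinite ordinal"
  using plus_ordinal_strict_mono[of y z x] by (auto simp: le_less)

lemma plus_one_le_plus_ordinal:
  "y \<le> x + z \<Longrightarrow> y + 1 \<le> x + (z + 1)" for x y z :: "'a::infinite ordinal"
  by (simp add: plus_ordinal_1 plus_ordinal_osuc osuc_le_iff less_osuc_iff)

text \<open>Monotonicity alone gives this inequality, so no continuity of addition at limits
  enters.\<close>

lemma SUP_le_plus_ordinal:
  fixes x :: "'a::infinite ordinal" and f g :: "nat \<Rightarrow> 'a ordinal"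
  assumes "\<And>n. f n \<le> x + g n"
  shows "(SUP n. f n) \<le> x + (SUP n. g n)"
proof (rule cSUP_least)
  fix n
  \<comment> \<open>\<open>SUP\<close> is an upper bound only for bounded families; countable ones
    are bounded in \<open>'a ordinal\<close>.\<close>
  have "g n \<le> (SUP n. g n)"
    by (simp add: cSUP_upper bdd_above_range_ordinal)
  then show "f n \<le> x + (SUP n. g n)"
    using assms[of n] plus_ordinal_mono_right order_trans by blast
qed simp

lemma sup_le_plus_ordinal:
  fixes x :: "'a::infinite ordinal"
  assumes "a \<le> x + c" "b \<le> x + d"
  shows "sup a b \<le> x + sup c d"
  using assms plus_ordinal_mono_right[of c "sup c d" x] plus_ordinal_mono_right[of d "sup c d" x]
  by (meson le_sup_iff order_trans sup_ge1 sup_ge2)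

lemma rank_rename: "rank (rename \<xi> M) = rank M"
  by (induction M arbitrary: \<xi>) simp_all

text \<open>The induction follows the typing derivation because the bound on images concerns only
  indices of \<Gamma>, and the derivation records how \<Gamma> grows under a binder.\<close>

lemma rank_subst_le:
  fixes \<beta> :: "'a::infinite ordinal"
  assumes "\<Gamma> \<turnstile> M : \<tau>" "\<And>i. i < length \<Gamma> \<Longrightarrow> rank (\<theta> i) \<le> \<beta>"
  shows "rank (subst \<theta> M) \<le> \<beta> + rank M"
  using assms
proof (induction arbitrary: \<theta> rule: typed.induct)
  case (Var i \<Gamma>)
  then show ?case by (simp add: plus_ordinal_0)
next
  case (Lam \<sigma> \<Gamma> M \<tau>)
  \<comment> \<open>The same \<beta> bounds the lifted substitution: the new variable has rank 0,
    and the old images are only renamed.\<close>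
  have "rank (case_nat (Var 0) (\<lambda>i. rename Suc (\<theta> i)) i) \<le> \<beta>" if "i < length (\<sigma> # \<Gamma>)" for i
    using that Lam.prems by (cases i) (simp_all add: rank_rename zero_le_ordinal)
  from Lam.IH[OF this] show ?case
    by (simp add: plus_one_le_plus_ordinal)
next
  case (App \<Gamma> F \<sigma> \<tau> V)
  show ?case
    unfolding subst.simps rank.simps
    by (intro plus_one_le_plus_ordinal sup_le_plus_ordinal App.IH App.prems)
next
  case (Lit \<Gamma> n)
  show ?case by (simp add: zero_le_ordinal)
next
  case (Query \<Gamma> M i)
  show ?case
    unfolding subst.simps rank.simps
    by (intro plus_one_le_plus_ordinal SUP_le_plus_ordinal Query.IH Query.prems)
next
  case (Case \<Gamma> N M)
  show ?case
    unfolding subst.simps rank.simps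
    by (intro plus_one_le_plus_ordinal sup_le_plus_ordinal SUP_le_plus_ordinal Case.IH Case.prems)
qed

lemma rank_subst1_le:
  assumes "\<sigma> # \<Gamma> \<turnstile> U : \<tau>"
  shows "rank (subst1 U V) \<le> (rank V + rank U :: 'a::infinite ordinal)"
  unfolding subst1_def using assms
proof (rule rank_subst_le)
  \<comment> \<open>Here \<beta> is \<open>rank V\<close>: index 0 goes to \<open>V\<close>, every
    other index to a variable of rank 0.\<close>
  show "rank (case_nat V Var i) \<le> (rank V :: 'a ordinal)" for i
    by (cases i) (simp_all add: zero_le_ordinal)
qed

theorem lemma9:
  fixes \<beta> :: "'a::infinite ordinal"
  shows "(\<forall>\<Gamma> \<Delta> \<xi> M \<tau>. \<Gamma> \<turnstile> M : \<tau> \<and> typed_ren \<Gamma> \<Delta> \<xi>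
            \<longrightarrow> rank (rename \<xi> M) = (rank M :: 'a ordinal))
       \<and> (\<forall>\<Gamma> \<Delta> \<theta> M \<tau>. \<Gamma> \<turnstile> M : \<tau> \<and> typed_subst \<Gamma> \<Delta> \<theta>
            \<and> (\<forall>i < length \<Gamma>. rank (\<theta> i) \<le> \<beta>)
            \<longrightarrow> rank (subst \<theta> M) \<le> \<beta> + rank M)
       \<and> (\<forall>\<Gamma> \<sigma> \<tau> U V. \<sigma> # \<Gamma> \<turnstile> U : \<tau> \<and> \<Gamma> \<turnstile> V : \<sigma>
            \<longrightarrow> rank (subst1 U V) \<le> rank V + (rank U :: 'a ordinal))"
  using rank_rename rank_subst_le rank_subst1_le by blast

end
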